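(* Let $\alpha>0$ and let $W_\alpha=(W_\alpha(u))_{u\ge0}$ be a centered Gaussian process which is a.s. locally Hölder continuous with exponent $\alpha$ and satisfies $W_\alpha(0)=0$ a.s. Let $\rho>-\alpha$ and let $Y_{\alpha,\rho}=(Y_{\alpha,\rho}(u))_{u\ge 0}$ be the process defined as follows: $Y_{\alpha,0}:=W_\alpha$; if $\rho>0$, $$Y_{\alpha,\rho}(u):=\rho\int_0^u(u-y)^{\rho-1}W_\alpha(y)\,\mathrm{d}y,\quad u>0;$$ if $-\alpha<\rho<0$, $$Y_{\alpha,\rho}(u):=u^\rho W_\alpha(u)+|\rho|\int_0^u\big(W_\alpha(u)-W_\alpha(u-y)\big)y^{\rho-1}\,\mathrm{d}y,\quad u>0;$$ and, for $\rho\neq0$, $Y_{\alpha,\rho}(0):=\lim_{u\to+0}Y_{\alpha,\rho}(u)$ (which equals $0$ a.s.). Then: 1) $|Y_{\alpha,\rho}(u)|<\infty$ a.s. for each fixed $u>0$ (in particular the defining integrals converge); 2) the process $Y_{\alpha,\rho}$ is a.s. locally Hölder continuous with exponent $\min(1,\alpha+\rho)$ if $\alpha+\rho\ne1$, and with arbitrary positive exponent less than $1$ if $\alpha+\rho=1$; more precisely, if $\alpha+\rho=1$, then for any $T>0$ and any $T^\ast>T$, $$\sup_{0\le u\ne v\le T}\frac{|Y_{\alpha,\rho}(u)-Y_{\alpha,\rho}(v)|}{|u-v|\log\big(T^\ast|u-v|^{-1}\big)}<\infty\quad\text{a.s.}$$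
   Context: A process $V=(V(u))_{u\ge0}$ is a.s. locally Hölder continuous with exponent $\gamma>0$ if for every $T>0$ there is an a.s. finite random variable $M_T$ such that $|V(x)-V(y)|\le M_T|x-y|^\gamma$ for all $0\le x,y\le T$. *)

theory Defs
  imports "HOL-Probability.Probability"
begin

text \<open>Point masses (zero variance) count as Gaussian.\<close>

definition gaussian_rv :: "'a measure \<Rightarrow> ('a \<Rightarrow> real) \<Rightarrow> bool" where
  "gaussian_rv M X \<longleftrightarrow> X \<in> borel_measurable M \<and>
     ((\<exists>\<mu>. AE \<omega> in M. X \<omega> = \<mu>) \<or>
      (\<exists>\<mu> \<sigma>. \<sigma> > 0 \<and> distributed M lborel X (normal_density \<mu> \<sigma>)))"

text \<open>A process \<open>(V(u))\<close>, \<open>u \<ge> 0\<close>, is a function \<open>real \<Rightarrow> 'a \<Rightarrow> real\<close> of which only the values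
  at nonnegative times matter.\<close>

definition gaussian_process :: "'a measure \<Rightarrow> (real \<Rightarrow> 'a \<Rightarrow> real) \<Rightarrow> bool" where
  "gaussian_process M W \<longleftrightarrow>
     (\<forall>F c. finite F \<and> F \<subseteq> {0..} \<longrightarrow> gaussian_rv M (\<lambda>\<omega>. \<Sum>u\<in>F. c u * W u \<omega>))"

definition centered_process :: "'a measure \<Rightarrow> (real \<Rightarrow> 'a \<Rightarrow> real) \<Rightarrow> bool" where
  "centered_process M W \<longleftrightarrow> (\<forall>u\<ge>0. integrable M (W u) \<and> integral\<^sup>L M (W u) = 0)"

definition as_locally_Holder :: "'a measure \<Rightarrow> real \<Rightarrow> (real \<Rightarrow> 'a \<Rightarrow> real) \<Rightarrow> bool" where
  "as_locally_Holder M \<gamma> V \<longleftrightarrow> \<gamma> > 0 \<and>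
     (\<forall>T>0. \<exists>K \<in> borel_measurable M. AE \<omega> in M.
        \<forall>x\<in>{0..T}. \<forall>y\<in>{0..T}. \<bar>V x \<omega> - V y \<omega>\<bar> \<le> K \<omega> * \<bar>x - y\<bar> powr \<gamma>)"

definition frac_integrand :: "real \<Rightarrow> (real \<Rightarrow> real) \<Rightarrow> real \<Rightarrow> real \<Rightarrow> real" where
  "frac_integrand \<rho> w u y =
     (if \<rho> > 0 then (u - y) powr (\<rho> - 1) * w y
      else (w u - w (u - y)) * y powr (\<rho> - 1))"

text \<open>The value of the path of \<open>Y\<close> at \<open>u > 0\<close>, driven by the path \<open>w\<close>. The integral is a Lebesgue
  integral (hence totalized to \<open>0\<close> when the integrand is not integrable); the junk values
  \<open>0 powr (\<rho> - 1) = 0\<close> occur only at an endpoint of the interval of integration.\<close>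

definition frac_path_pos :: "real \<Rightarrow> (real \<Rightarrow> real) \<Rightarrow> real \<Rightarrow> real" where
  "frac_path_pos \<rho> w u =
     (if \<rho> = 0 then w u
      else if \<rho> > 0 then \<rho> * (LBINT y:{0..u}. frac_integrand \<rho> w u y)
      else u powr \<rho> * w u + \<bar>\<rho>\<bar> * (LBINT y:{0..u}. frac_integrand \<rho> w u y))"

definition frac_process :: "real \<Rightarrow> (real \<Rightarrow> 'a \<Rightarrow> real) \<Rightarrow> real \<Rightarrow> 'a \<Rightarrow> real" where
  "frac_process \<rho> W u \<omega> =
     (if \<rho> \<noteq> 0 \<and> u = 0 then Lim (at_right 0) (frac_path_pos \<rho> (\<lambda>t. W t \<omega>))
      else frac_path_pos \<rho> (\<lambda>t. W t \<omega>) u)"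

end

theory Submission
  imports Defs
begin

text \<open>The statement is pathwise: only \<open>w 0 = 0\<close> and the Hoelder bound
  \<open>\<bar>w x - w y\<bar> \<le> K * \<bar>x - y\<bar> powr \<alpha>\<close> on \<open>[0, T]\<close> matter. For every sign of \<open>\<rho>\<close> the process equals
  \<open>u powr \<rho> * w u - \<rho> * (integral over [0, u] of (w u - w y) * (u - y) powr (\<rho> - 1))\<close>, whose
  integrand is dominated by \<open>K * (u - y) powr (\<alpha> + \<rho> - 1)\<close>. For an increment from \<open>v\<close> to \<open>v + h\<close>
  with \<open>h \<le> v\<close>, cut both integrals at \<open>v - h\<close>: the parts near \<open>v\<close> are of order \<open>h powr (\<alpha> + \<rho>)\<close>,
  while in the far part the mean value theorem for the kernel leaves \<open>h\<close> times the integral of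
  \<open>s powr (\<alpha> + \<rho> - 2)\<close> over \<open>[h, v]\<close>. The three regimes of that integral give the three moduli.
  If \<open>h > v\<close>, the growth bound at both endpoints suffices. All constants are independent of the
  path, so the random Hoelder constant stays measurable.\<close>

section \<open>Integrals of powers, dominated integrability and differences of powers\<close>

lemma has_integral_reflect_Icc:
  fixes f :: "real \<Rightarrow> real"
  assumes "(f has_integral i) {a..b}"
  shows "((\<lambda>y. f (u - y)) has_integral i) {u - b..u - a}"
proof -
  have "((\<lambda>y. f (- y)) has_integral i) {- b..- a}"
    using assms by simp
  from has_integral_shift_real_ivl[OF this, of "- u"]
  show ?thesis by (simp add: algebra_simps)
qed

lemma has_integral_powr_end:
  fixes a u \<beta> :: real
  assumes "0 < \<beta>" "a \<le> u"
  shows "((\<lambda>y. (u - y) powr (\<beta> - 1)) has_integral (u - a) powr \<beta> / \<beta>) {a..u}"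
  using has_integral_reflect_Icc[OF has_integral_powr_from_0[of "\<beta> - 1" "u - a"], of u] assms
  by simp

text \<open>As \<open>a < u\<close> keeps the singularity outside the interval, the exponent may
  have any sign. Leaving the factor \<open>r\<close> in the integrand avoids a division, so
  \<open>r = 0\<close> is covered too.\<close>

lemma has_integral_powr_away:
  fixes a u r :: real
  assumes "0 \<le> a" "a < u"
  shows "((\<lambda>y. r * (u - y) powr (r - 1)) has_integral u powr r - (u - a) powr r) {0..a}"
proof -
  have "((\<lambda>y. r * (u - y) powr (r - 1)) has_integral
          - ((u - a) powr r) - - ((u - 0) powr r)) {0..a}"
  proof (rule fundamental_theorem_of_calculus)
    fix x assume x: "x \<in> {0..a}"
    have "((\<lambda>y. - ((u - y) powr r)) has_real_derivative r * (u - x) powr (r - 1)) (at x within {0..a})"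
      using x assms by (auto intro!: derivative_eq_intros)
    then show "((\<lambda>y. - ((u - y) powr r)) has_vector_derivative r * (u - x) powr (r - 1))
                (at x within {0..a})"
      by (simp add: has_real_derivative_iff_has_vector_derivative)
  qed (use assms in auto)
  then show ?thesis by simp
qed

text \<open>This is the bridge from gauge integrals, in which the calculus is done, to Lebesgue
  integrability. A nonnegative gauge integrable \<open>g\<close> is absolutely integrable, hence
  integrable for the completed measure; Borel measurability of \<open>g\<close> brings this down to
  \<open>lborel\<close>, and domination passes it on to \<open>f\<close>.\<close>

lemma set_integrable_lborel_dominated:
  fixes f g :: "real \<Rightarrow> real"
  assumes "g \<in> borel_measurable borel" "(g has_integral i) {a..b}" "\<And>y. y \<in> {a..b} \<Longrightarrow> 0 \<le> g y"
    and "set_borel_measurable borel {a..b} f" "\<And>y. y \<in> {a..b} \<Longrightarrow> \<bar>f y\<bar> \<le> g y"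
  shows "set_integrable lborel {a..b} f"
proof (rule set_integrable_bound)
  have "g absolutely_integrable_on {a..b}"
    using assms by (intro nonnegative_absolutely_integrable_1) auto
  then show "set_integrable lborel {a..b} g"
    unfolding set_integrable_def using assms(1)
    by (subst (asm) integrable_completion) auto
  show "set_borel_measurable lborel {a..b} f"
    using assms(4) by (simp add: set_borel_measurable_def)
  show "AE x in lborel. x \<in> {a..b} \<longrightarrow> norm (f x) \<le> norm (g x)"
    using assms(3,5) by (intro AE_I2) force
qed

lemma set_borel_measurable_mult_Icc:
  fixes f g :: "real \<Rightarrow> real"
  assumes "continuous_on {a..b} f" "g \<in> borel_measurable borel"
  shows "set_borel_measurable borel {a..b} (\<lambda>x. f x * g x)"
proof -
  have "(\<lambda>x. (indicator {a..b} x *\<^sub>R f x) * g x) \<in> borel_measurable borel"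
    using borel_measurable_continuous_on_indicator[OF _ assms(1)] assms(2)
    by (intro borel_measurable_times) auto
  then show ?thesis by (simp add: set_borel_measurable_def mult.assoc)
qed

text \<open>By the mean value theorem the difference is
  \<open>(q - p) * (r * z powr (r - 1))\<close> with \<open>z\<close> between \<open>p\<close> and
  \<open>q\<close>. Since \<open>z / p\<close> lies in \<open>[1, 2]\<close>, replacing
  \<open>z\<close> by \<open>p\<close> costs at most the factor
  \<open>2 powr \<bar>r - 1\<bar>\<close>, whatever the sign of \<open>r - 1\<close>.\<close>

lemma powr_diff_le:
  fixes p q r :: real
  assumes "0 < p" "p \<le> q" "q \<le> 2 * p"
  shows "\<bar>q powr r - p powr r\<bar> \<le> \<bar>r\<bar> * 2 powr \<bar>r - 1\<bar> * (q - p) * p powr (r - 1)"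
proof (cases "p = q")
  case False
  with assms have "p < q" by simp
  have "\<exists>z>p. z < q \<and> q powr r - p powr r = (q - p) * (r * z powr (r - 1))"
    using assms by (intro MVT2[OF \<open>p < q\<close>]) (auto intro!: derivative_eq_intros)
  then obtain z where z: "p < z" "z < q"
    and eq: "q powr r - p powr r = (q - p) * (r * z powr (r - 1))" by blast
  have "(z / p) powr (r - 1) \<le> (z / p) powr \<bar>r - 1\<bar>"
    using z assms by (intro powr_mono) auto
  also have "\<dots> \<le> 2 powr \<bar>r - 1\<bar>"
    using z assms by (intro powr_mono2) (auto simp: field_simps)
  finally have "z powr (r - 1) \<le> 2 powr \<bar>r - 1\<bar> * p powr (r - 1)"
    using z assms by (simp add: powr_divide field_simps)
  then have "\<bar>r\<bar> * (q - p) * z powr (r - 1) \<le> \<bar>r\<bar> * (q - p) * (2 powr \<bar>r - 1\<bar> * p powr (r - 1))"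
    using \<open>p < q\<close> by (intro mult_left_mono) auto
  then show ?thesis
    using \<open>p < q\<close> by (simp add: eq abs_mult mult_ac)
qed auto

section \<open>A single path: integrability, growth and increments\<close>

locale Holder_path =
  fixes \<alpha> \<rho> T K :: real and w :: "real \<Rightarrow> real"
  assumes alpha_pos: "0 < \<alpha>" and sum_pos: "0 < \<alpha> + \<rho>" and T_pos: "0 < T"
    and w_0: "w 0 = 0"
    and holder: "\<And>x y. x \<in> {0..T} \<Longrightarrow> y \<in> {0..T} \<Longrightarrow> \<bar>w x - w y\<bar> \<le> K * \<bar>x - y\<bar> powr \<alpha>"
begin

definition kern :: "real \<Rightarrow> real \<Rightarrow> real" where
  "kern u y = (w u - w y) * (u - y) powr (\<rho> - 1)"

text \<open>One formula serves every sign of \<open>\<rho>\<close>. The gauge integral is used so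
  that intervals can be split and explicit integrals inserted directly.\<close>

definition regularized :: "real \<Rightarrow> real" where
  "regularized u = u powr \<rho> * w u - \<rho> * integral {0..u} (kern u)"

lemma K_nonneg: "0 \<le> K"
proof -
  have "0 \<le> K * T powr \<alpha>" using holder[of T 0] T_pos by auto
  then show ?thesis using T_pos by (simp add: zero_le_mult_iff)
qed

lemma continuous_on_w: "continuous_on {0..T} w"
proof (rule continuous_onI)
  fix x e :: real assume x: "x \<in> {0..T}" and e: "0 < e"
  \<comment> \<open>Chosen so that \<open>d powr \<alpha> = e / (K + 1)\<close>; the added 1 allows
    \<open>K = 0\<close>.\<close>
  define d where "d = (e / (K + 1)) powr (1 / \<alpha>)"
  have "0 < d" using e K_nonneg by (simp add: d_def)
  moreover have "dist (w y) (w x) \<le> e" if "y \<in> {0..T}" "dist y x < d" for y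
  proof -
    have "\<bar>y - x\<bar> powr \<alpha> \<le> d powr \<alpha>"
      using that alpha_pos by (intro powr_mono2) (auto simp: dist_real_def)
    also have "\<dots> = e / (K + 1)"
      using alpha_pos e K_nonneg by (simp add: d_def powr_powr)
    finally have "K * \<bar>y - x\<bar> powr \<alpha> \<le> K * (e / (K + 1))"
      using K_nonneg by (intro mult_left_mono)
    also have "\<dots> \<le> e" using K_nonneg e by (simp add: field_simps)
    finally show ?thesis using holder[OF that(1) x] by (simp add: dist_real_def)
  qed
  ultimately show "\<exists>d>0. \<forall>x'\<in>{0..T}. dist x' x < d \<longrightarrow> dist (w x') (w x) \<le> e"
    by blast
qed

text \<open>The increment of \<open>w\<close> contributes \<open>\<alpha>\<close> to the exponent,
  which then exceeds -1, so the singularity at \<open>u\<close> becomes integrable. At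
  \<open>y = u\<close> both sides are 0 because \<open>0 powr\<close> anything is 0.\<close>

lemma kern_bound:
  assumes "u \<in> {0..T}" "y \<in> {0..u}"
  shows "\<bar>kern u y\<bar> \<le> K * (u - y) powr (\<alpha> + \<rho> - 1)"
proof -
  have "\<bar>w u - w y\<bar> * (u - y) powr (\<rho> - 1) \<le> (K * (u - y) powr \<alpha>) * (u - y) powr (\<rho> - 1)"
    using holder[of u y] assms by (intro mult_right_mono) auto
  then show ?thesis
    by (simp add: kern_def abs_mult mult.assoc powr_add[symmetric] add_diff_eq)
qed

lemma set_integrable_kern:
  assumes "u \<in> {0..T}"
  shows "set_integrable lborel {0..u} (kern u)"
proof (rule set_integrable_lborel_dominated)
  show "((\<lambda>y. K * (u - y) powr (\<alpha> + \<rho> - 1)) has_integral K * (u powr (\<alpha> + \<rho>) / (\<alpha> + \<rho>))) {0..u}"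
    using has_integral_mult_right[OF has_integral_powr_end[OF sum_pos, of 0 u]] assms by simp
  have "continuous_on {0..u} (\<lambda>y. w u - w y)"
    using assms by (intro continuous_intros continuous_on_subset[OF continuous_on_w]) auto
  then show "set_borel_measurable borel {0..u} (kern u)"
    unfolding kern_def[abs_def] by (rule set_borel_measurable_mult_Icc) measurable
qed (use kern_bound[OF assms] K_nonneg in auto)

lemma kern_integrable:
  assumes "u \<in> {0..T}" "0 \<le> a" "b \<le> u"
  shows "kern u integrable_on {a..b}"
  by (rule integrable_on_subinterval[OF
        set_borel_integral_eq_integral(1)[OF set_integrable_kern[OF assms(1)]]])
     (use assms in auto)

lemma kern_integral_bound:
  assumes "u \<in> {0..T}" "0 \<le> a" "a \<le> u"
  shows "\<bar>integral {a..u} (kern u)\<bar> \<le> K * ((u - a) powr (\<alpha> + \<rho>) / (\<alpha> + \<rho>))"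
proof -
  have I: "((\<lambda>y. K * (u - y) powr (\<alpha> + \<rho> - 1)) has_integral
      K * ((u - a) powr (\<alpha> + \<rho>) / (\<alpha> + \<rho>))) {a..u}"
    by (intro has_integral_mult_right has_integral_powr_end sum_pos assms)
  have "norm (integral {a..u} (kern u)) \<le> integral {a..u} (\<lambda>y. K * (u - y) powr (\<alpha> + \<rho> - 1))"
    using kern_bound[OF assms(1)] kern_integrable[OF assms(1,2) order_refl] I assms
    by (intro Henstock_Kurzweil_Integration.integral_norm_bound_integral) auto
  then show ?thesis unfolding integral_unique[OF I] by simp
qed

text \<open>For \<open>\<rho> > 0\<close> the kernel itself is integrable and \<open>w\<close> is
  bounded on \<open>[0, T]\<close>. For \<open>\<rho> < 0\<close> the kernel alone is not integrable
  at 0, and the increment of \<open>w\<close> is what compensates.\<close>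

lemma set_integrable_frac_integrand:
  assumes "\<rho> \<noteq> 0" "u \<in> {0..T}"
  shows "set_integrable lborel {0..u} (frac_integrand \<rho> w u)"
proof (cases "\<rho> > 0")
  case True
  have cont: "continuous_on {0..u} w"
    using assms by (intro continuous_on_subset[OF continuous_on_w]) auto
  have "set_integrable lborel {0..u} (\<lambda>y. w y * (u - y) powr (\<rho> - 1))"
  proof (rule set_integrable_lborel_dominated)
    show "((\<lambda>y. K * T powr \<alpha> * (u - y) powr (\<rho> - 1)) has_integral
        K * T powr \<alpha> * ((u - 0) powr \<rho> / \<rho>)) {0..u}"
      using assms by (intro has_integral_mult_right has_integral_powr_end True) auto
    show "set_borel_measurable borel {0..u} (\<lambda>y. w y * (u - y) powr (\<rho> - 1))"
      using cont by (rule set_borel_measurable_mult_Icc) measurable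
    fix y assume y: "y \<in> {0..u}"
    have "\<bar>w y\<bar> \<le> K * y powr \<alpha>"
      using holder[of y 0] y assms by (auto simp: w_0)
    also have "\<dots> \<le> K * T powr \<alpha>"
      using y assms alpha_pos K_nonneg by (intro mult_left_mono powr_mono2) auto
    finally show "\<bar>w y * (u - y) powr (\<rho> - 1)\<bar> \<le> K * T powr \<alpha> * (u - y) powr (\<rho> - 1)"
      by (simp add: abs_mult mult_right_mono)
  qed (use K_nonneg in auto)
  then show ?thesis
    using True by (simp add: frac_integrand_def[abs_def] mult.commute)
next
  case False
  have "set_integrable lborel {0..u} (\<lambda>y. (w u - w (u - y)) * y powr (\<rho> - 1))"
  proof (rule set_integrable_lborel_dominated)
    show "((\<lambda>y. K * y powr (\<alpha> + \<rho> - 1)) has_integral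
        K * (u powr (\<alpha> + \<rho> - 1 + 1) / (\<alpha> + \<rho> - 1 + 1))) {0..u}"
      using assms sum_pos by (intro has_integral_mult_right has_integral_powr_from_0) auto
    have "continuous_on {0..u} (\<lambda>y. w u - w (u - y))"
      using assms by (intro continuous_intros continuous_on_compose2[OF continuous_on_w]) auto
    then show "set_borel_measurable borel {0..u} (\<lambda>y. (w u - w (u - y)) * y powr (\<rho> - 1))"
      by (rule set_borel_measurable_mult_Icc) measurable
    fix y assume "y \<in> {0..u}"
    \<comment> \<open>The integrand is the reflection \<open>kern u (u - y)\<close>, so
      \<open>kern_bound\<close> applies.\<close>
    then show "\<bar>(w u - w (u - y)) * y powr (\<rho> - 1)\<bar> \<le> K * y powr (\<alpha> + \<rho> - 1)"
      using kern_bound[of u "u - y"] assms by (auto simp: kern_def)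
  qed (use K_nonneg in auto)
  then show ?thesis
    using False by (simp add: frac_integrand_def[abs_def])
qed

text \<open>For \<open>\<rho> > 0\<close>, write \<open>w y = w u - (w u - w y)\<close>: the
  constant part integrates to \<open>w u * (u powr \<rho> / \<rho>)\<close> and the rest is
  \<open>kern u\<close>. For \<open>\<rho> < 0\<close>, the reflection of \<open>y\<close> to
  \<open>u - y\<close> gives \<open>kern u\<close>, and
  \<open>\<bar>\<rho>\<bar> = - \<rho>\<close>. For \<open>\<rho> = 0\<close> only
  \<open>u powr 0 * w u = w u\<close> survives.\<close>

lemma frac_path_pos_eq_regularized:
  assumes "0 < u" "u \<le> T"
  shows "frac_path_pos \<rho> w u = regularized u"
proof -
  have u: "u \<in> {0..T}" using assms by simp
  have I: "(kern u has_integral integral {0..u} (kern u)) {0..u}"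
    using kern_integrable[OF u order_refl order_refl] by (rule integrable_integral)
  consider "\<rho> = 0" | "\<rho> > 0" | "\<rho> < 0" by linarith
  then show ?thesis
  proof cases
    case 1
    then show ?thesis unfolding frac_path_pos_def regularized_def using assms by simp
  next
    case 2
    have "((\<lambda>y. w u * (u - y) powr (\<rho> - 1) - kern u y) has_integral
        w u * ((u - 0) powr \<rho> / \<rho>) - integral {0..u} (kern u)) {0..u}"
      using assms 2 by (intro has_integral_diff has_integral_mult_right has_integral_powr_end I) auto
    moreover have "(\<lambda>y. w u * (u - y) powr (\<rho> - 1) - kern u y) = frac_integrand \<rho> w u"
      using 2 by (auto simp: kern_def frac_integrand_def algebra_simps)
    ultimately have "integral {0..u} (frac_integrand \<rho> w u)
        = w u * (u powr \<rho> / \<rho>) - integral {0..u} (kern u)"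
      by (simp add: integral_unique)
    then show ?thesis
      using 2 set_borel_integral_eq_integral(2)[OF set_integrable_frac_integrand[OF _ u]]
      by (simp add: frac_path_pos_def regularized_def right_diff_distrib)
  next
    case 3
    have "(\<lambda>y. kern u (u - y)) = frac_integrand \<rho> w u"
      using 3 by (auto simp: kern_def frac_integrand_def)
    then have "integral {0..u} (frac_integrand \<rho> w u) = integral {0..u} (kern u)"
      using has_integral_reflect_Icc[OF I, of u] by (simp add: integral_unique)
    then show ?thesis
      using 3 set_borel_integral_eq_integral(2)[OF set_integrable_frac_integrand[OF _ u]]
      by (simp add: frac_path_pos_def regularized_def)
  qed
qed

lemma regularized_0: "regularized 0 = 0"
  by (simp add: regularized_def w_0)

text \<open>This yields both the limit 0 at the origin and the increments that are longer than their
  left endpoint.\<close>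

lemma regularized_growth:
  assumes "u \<in> {0..T}"
  shows "\<bar>regularized u\<bar> \<le> (1 + \<bar>\<rho>\<bar> / (\<alpha> + \<rho>)) * K * u powr (\<alpha> + \<rho>)"
proof -
  have "\<bar>w u\<bar> \<le> K * u powr \<alpha>"
    using holder[of u 0] assms by (auto simp: w_0)
  then have "u powr \<rho> * \<bar>w u\<bar> \<le> u powr \<rho> * (K * u powr \<alpha>)"
    by (intro mult_left_mono) auto
  then have 1: "\<bar>u powr \<rho> * w u\<bar> \<le> K * u powr (\<alpha> + \<rho>)"
    by (simp add: abs_mult powr_add mult_ac)
  have "\<bar>\<rho>\<bar> * \<bar>integral {0..u} (kern u)\<bar> \<le> \<bar>\<rho>\<bar> * (K * ((u - 0) powr (\<alpha> + \<rho>) / (\<alpha> + \<rho>)))"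
    using assms by (intro mult_left_mono kern_integral_bound) auto
  then have "\<bar>\<rho> * integral {0..u} (kern u)\<bar> \<le> \<bar>\<rho>\<bar> / (\<alpha> + \<rho>) * K * u powr (\<alpha> + \<rho>)"
    by (simp add: abs_mult mult_ac)
  with 1 show ?thesis
    unfolding regularized_def by (simp add: distrib_right)
qed


text \<open>On this range \<open>h \<le> v - y\<close>, so
  \<open>v + h - y \<le> 2 * (v - y)\<close> and \<open>powr_diff_le\<close> bounds the kernel
  difference by a multiple of \<open>h * (v - y) powr (\<rho> - 2)\<close>. The Hoelder bound on
  \<open>w y - w v\<close> raises the exponent by \<open>\<alpha>\<close>.\<close>

lemma kern_difference_far:
  assumes "v \<in> {0..T}" "0 < h" "h \<le> v" "v + h \<le> T"
  shows "\<bar>integral {0..v - h} (\<lambda>y. (w y - w v) * ((v + h - y) powr (\<rho> - 1) - (v - y) powr (\<rho> - 1)))\<bar>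
    \<le> \<bar>\<rho> - 1\<bar> * 2 powr \<bar>\<rho> - 2\<bar> * K * (h * integral {0..v - h} (\<lambda>y. (v - y) powr (\<alpha> + \<rho> - 2)))"
    (is "\<bar>integral _ ?f\<bar> \<le> ?C * (h * integral _ ?g)")
proof -
  have g: "?g integrable_on {0..v - h}"
    using assms by (intro integrable_continuous_real continuous_intros) auto
  have f: "?f integrable_on {0..v - h}"
    using assms by (intro integrable_continuous_real continuous_intros
        continuous_on_subset[OF continuous_on_w]) auto
  have "norm (integral {0..v - h} ?f) \<le> integral {0..v - h} (\<lambda>y. ?C * h * ?g y)"
  proof (rule Henstock_Kurzweil_Integration.integral_norm_bound_integral[OF f])
    show "(\<lambda>y. ?C * h * ?g y) integrable_on {0..v - h}"
      by (rule integrable_on_mult_right[OF g])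
    fix y assume y: "y \<in> {0..v - h}"
    have 1: "\<bar>w y - w v\<bar> \<le> K * (v - y) powr \<alpha>"
      using holder[of v y] y assms by (auto simp: abs_minus_commute)
    have 2: "\<bar>(v + h - y) powr (\<rho> - 1) - (v - y) powr (\<rho> - 1)\<bar>
        \<le> \<bar>\<rho> - 1\<bar> * 2 powr \<bar>\<rho> - 2\<bar> * h * (v - y) powr (\<rho> - 2)"
      using powr_diff_le[of "v - y" "v + h - y" "\<rho> - 1"] y assms by simp
    have "\<bar>?f y\<bar> \<le> (K * (v - y) powr \<alpha>)
        * (\<bar>\<rho> - 1\<bar> * 2 powr \<bar>\<rho> - 2\<bar> * h * (v - y) powr (\<rho> - 2))"
      unfolding abs_mult using K_nonneg by (intro mult_mono 1 2) auto
    also have "\<dots> = ?C * h * ((v - y) powr \<alpha> * (v - y) powr (\<rho> - 2))"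
      by (simp add: mult_ac)
    also have "\<dots> = ?C * h * ?g y"
      by (simp add: powr_add[symmetric] add_diff_eq)
    finally show "norm (?f y) \<le> ?C * h * ?g y" by simp
  qed
  then show ?thesis by (simp add: mult.assoc)
qed

text \<open>Replacing \<open>w (v + h)\<close> by \<open>w v\<close> in the far part makes both kernels multiply the same
  increment \<open>w y - w v\<close>; the correction is integrated explicitly.\<close>

lemma regularized_difference:
  assumes "0 < h" "h \<le> v" "v + h \<le> T"
  shows "regularized (v + h) - regularized v =
    (2 * h) powr \<rho> * (w (v + h) - w v) + w v * ((v + h) powr \<rho> - v powr \<rho>)
    - \<rho> * integral {v - h..v + h} (kern (v + h)) + \<rho> * integral {v - h..v} (kern v)
    + \<rho> * integral {0..v - h} (\<lambda>y. (w y - w v) * ((v + h - y) powr (\<rho> - 1) - (v - y) powr (\<rho> - 1)))"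
    (is "_ = _ + _ - _ + _ + \<rho> * integral {0..?a} ?f")
proof -
  let ?u = "v + h"
  have k: "kern ?u integrable_on {0..?u}" "kern v integrable_on {0..v}"
    "kern ?u integrable_on {0..?a}" "kern v integrable_on {0..?a}"
    using assms by (auto intro!: kern_integrable)
  have split_u: "integral {0..?u} (kern ?u) = integral {0..?a} (kern ?u) + integral {?a..?u} (kern ?u)"
    using assms k by (intro Henstock_Kurzweil_Integration.integral_combine[symmetric]) auto
  have split_v: "integral {0..v} (kern v) = integral {0..?a} (kern v) + integral {?a..v} (kern v)"
    using assms k by (intro Henstock_Kurzweil_Integration.integral_combine[symmetric]) auto
  \<comment> \<open>The integrand equals \<open>\<rho> * ?f y\<close>, because
    \<open>(w ?u - w v) - (w ?u - w y) = w y - w v\<close>. Its first term is integrated by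
    \<open>has_integral_powr_away\<close>, with \<open>?u - ?a = 2 * h\<close> at the upper
    end.\<close>
  have "((\<lambda>y. (w ?u - w v) * (\<rho> * (?u - y) powr (\<rho> - 1)) - \<rho> * (kern ?u y - kern v y)) has_integral
      (w ?u - w v) * (?u powr \<rho> - (?u - ?a) powr \<rho>)
      - \<rho> * (integral {0..?a} (kern ?u) - integral {0..?a} (kern v))) {0..?a}"
    using assms k(3,4)
    by (intro has_integral_diff has_integral_mult_right has_integral_powr_away integrable_integral) auto
  moreover have "(\<lambda>y. (w ?u - w v) * (\<rho> * (?u - y) powr (\<rho> - 1)) - \<rho> * (kern ?u y - kern v y))
      = (\<lambda>y. \<rho> * ?f y)"
    by (auto simp: kern_def algebra_simps)
  ultimately have "((\<lambda>y. \<rho> * ?f y) has_integral (w ?u - w v) * (?u powr \<rho> - (?u - ?a) powr \<rho>)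
      - \<rho> * (integral {0..?a} (kern ?u) - integral {0..?a} (kern v))) {0..?a}"
    by (simp only:)
  from integral_unique[OF this]
  have "\<rho> * integral {0..?a} ?f = (w ?u - w v) * (?u powr \<rho> - (2 * h) powr \<rho>)
      - \<rho> * (integral {0..?a} (kern ?u) - integral {0..?a} (kern v))"
    unfolding integral_mult_right by simp
  then have far: "\<rho> * integral {0..?a} ?f = (w ?u - w v) * ?u powr \<rho> - (w ?u - w v) * (2 * h) powr \<rho>
      - \<rho> * integral {0..?a} (kern ?u) + \<rho> * integral {0..?a} (kern v)"
    by (simp only: right_diff_distrib)
  \<comment> \<open>Here \<open>p\<close>, \<open>q\<close>, \<open>r\<close> stand for the powers
    of \<open>v + h\<close>, \<open>v\<close>, \<open>2 * h\<close>, while \<open>A\<close>,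
    \<open>A'\<close> are the far integrals and \<open>B\<close>, \<open>B'\<close> the near ones.
    With free variables, simplification cannot rewrite inside the integrals.\<close>
  have ring: "p * x - \<rho> * (A + B) - (q * y - \<rho> * (A' + B')) =
      r * (x - y) + y * (p - q) - \<rho> * B + \<rho> * B' + ((x - y) * p - (x - y) * r - \<rho> * A + \<rho> * A')"
    for p q r x y A B A' B' :: real
    by (simp add: algebra_simps)
  show ?thesis
    unfolding regularized_def split_u split_v far by (rule ring)
qed

text \<open>The five terms of \<open>regularized_difference\<close> are bounded one by one. In
  \<open>C\<close>, \<open>2 powr \<rho>\<close> comes from the increment of \<open>w\<close>, the
  second summand from \<open>powr_diff_le\<close> for the powers of \<open>v + h\<close> and
  \<open>v\<close>, the third from the near integrals over lengths \<open>2 * h\<close> and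
  \<open>h\<close>, the last from the far part. All summands are nonnegative, so \<open>C\<close>
  dominates each coefficient.\<close>

lemma regularized_increment_near:
  assumes "0 < h" "h \<le> v" "v + h \<le> T"
  defines "C \<equiv> 2 powr \<rho> + \<bar>\<rho>\<bar> * 2 powr \<bar>\<rho> - 1\<bar> + \<bar>\<rho>\<bar> * (2 powr (\<alpha> + \<rho>) + 1) / (\<alpha> + \<rho>)
    + \<bar>\<rho>\<bar> * \<bar>\<rho> - 1\<bar> * 2 powr \<bar>\<rho> - 2\<bar>"
  shows "\<bar>regularized (v + h) - regularized v\<bar> \<le> C * K * (h powr (\<alpha> + \<rho>)
    + h * v powr (\<alpha> + \<rho> - 1) + h * integral {0..v - h} (\<lambda>y. (v - y) powr (\<alpha> + \<rho> - 2)))"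
proof -
  define \<beta> where "\<beta> = \<alpha> + \<rho>"
  define D where "D = h * integral {0..v - h} (\<lambda>y. (v - y) powr (\<beta> - 2))"
  have \<beta>: "0 < \<beta>" using sum_pos by (simp add: \<beta>_def)
  have D: "0 \<le> D"
    unfolding D_def using assms
    by (intro mult_nonneg_nonneg Henstock_Kurzweil_Integration.integral_nonneg
        integrable_continuous_real continuous_intros) auto
  have "(2 * h) powr \<rho> * \<bar>w (v + h) - w v\<bar> \<le> (2 * h) powr \<rho> * (K * h powr \<alpha>)"
    using holder[of "v + h" v] assms by (intro mult_left_mono) auto
  also have "\<dots> = 2 powr \<rho> * K * h powr \<beta>"
    using assms by (simp add: powr_mult powr_add \<beta>_def mult_ac)
  finally have 1: "\<bar>(2 * h) powr \<rho> * (w (v + h) - w v)\<bar> \<le> 2 powr \<rho> * K * h powr \<beta>"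
    by (simp add: abs_mult)
  have "\<bar>w v\<bar> \<le> K * v powr \<alpha>"
    using holder[of v 0] assms by (auto simp: w_0)
  then have "\<bar>w v\<bar> * \<bar>(v + h) powr \<rho> - v powr \<rho>\<bar>
      \<le> (K * v powr \<alpha>) * (\<bar>\<rho>\<bar> * 2 powr \<bar>\<rho> - 1\<bar> * (v + h - v) * v powr (\<rho> - 1))"
    using assms K_nonneg by (intro mult_mono powr_diff_le) auto
  also have "\<dots> = \<bar>\<rho>\<bar> * 2 powr \<bar>\<rho> - 1\<bar> * K * (h * (v powr \<alpha> * v powr (\<rho> - 1)))"
    by (simp add: mult_ac)
  also have "\<dots> = \<bar>\<rho>\<bar> * 2 powr \<bar>\<rho> - 1\<bar> * K * (h * v powr (\<beta> - 1))"
    by (simp add: powr_add[symmetric] add_diff_eq \<beta>_def)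
  finally have 2: "\<bar>w v * ((v + h) powr \<rho> - v powr \<rho>)\<bar>
      \<le> \<bar>\<rho>\<bar> * 2 powr \<bar>\<rho> - 1\<bar> * K * (h * v powr (\<beta> - 1))"
    by (simp add: abs_mult)
  have "\<bar>\<rho>\<bar> * \<bar>integral {v - h..v + h} (kern (v + h))\<bar>
      \<le> \<bar>\<rho>\<bar> * (K * ((v + h - (v - h)) powr \<beta> / \<beta>))"
    unfolding \<beta>_def using assms by (intro mult_left_mono kern_integral_bound) auto
  then have 3: "\<bar>\<rho> * integral {v - h..v + h} (kern (v + h))\<bar> \<le> \<bar>\<rho>\<bar> * 2 powr \<beta> / \<beta> * K * h powr \<beta>"
    using assms by (simp add: abs_mult powr_mult mult_ac)
  have "\<bar>\<rho>\<bar> * \<bar>integral {v - h..v} (kern v)\<bar> \<le> \<bar>\<rho>\<bar> * (K * ((v - (v - h)) powr \<beta> / \<beta>))"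
    unfolding \<beta>_def using assms by (intro mult_left_mono kern_integral_bound) auto
  then have 4: "\<bar>\<rho> * integral {v - h..v} (kern v)\<bar> \<le> \<bar>\<rho>\<bar> / \<beta> * K * h powr \<beta>"
    by (simp add: abs_mult mult_ac)
  have "\<bar>\<rho>\<bar> * \<bar>integral {0..v - h} (\<lambda>y. (w y - w v) * ((v + h - y) powr (\<rho> - 1) - (v - y) powr (\<rho> - 1)))\<bar>
      \<le> \<bar>\<rho>\<bar> * (\<bar>\<rho> - 1\<bar> * 2 powr \<bar>\<rho> - 2\<bar> * K * D)"
    unfolding D_def \<beta>_def using assms by (intro mult_left_mono kern_difference_far) auto
  then have 5: "\<bar>\<rho> * integral {0..v - h} (\<lambda>y. (w y - w v) * ((v + h - y) powr (\<rho> - 1) - (v - y) powr (\<rho> - 1)))\<bar>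
      \<le> \<bar>\<rho>\<bar> * \<bar>\<rho> - 1\<bar> * 2 powr \<bar>\<rho> - 2\<bar> * K * D"
    by (simp add: abs_mult mult_ac)
  have "\<bar>regularized (v + h) - regularized v\<bar> \<le>
      (2 powr \<rho> * K * h powr \<beta>) + \<bar>\<rho>\<bar> * 2 powr \<bar>\<rho> - 1\<bar> * K * (h * v powr (\<beta> - 1))
      + \<bar>\<rho>\<bar> * 2 powr \<beta> / \<beta> * K * h powr \<beta> + \<bar>\<rho>\<bar> / \<beta> * K * h powr \<beta>
      + \<bar>\<rho>\<bar> * \<bar>\<rho> - 1\<bar> * 2 powr \<bar>\<rho> - 2\<bar> * K * D"
    unfolding regularized_difference[OF assms(1-3)] using 1 2 3 4 5 by linarith
  also have "\<dots> = (2 powr \<rho> + \<bar>\<rho>\<bar> * (2 powr \<beta> + 1) / \<beta>) * K * h powr \<beta>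
      + (\<bar>\<rho>\<bar> * 2 powr \<bar>\<rho> - 1\<bar>) * K * (h * v powr (\<beta> - 1))
      + (\<bar>\<rho>\<bar> * \<bar>\<rho> - 1\<bar> * 2 powr \<bar>\<rho> - 2\<bar>) * K * D"
    by (simp add: algebra_simps add_divide_distrib)
  also have "\<dots> \<le> C * K * h powr \<beta> + C * K * (h * v powr (\<beta> - 1)) + C * K * D"
  proof -
    have "0 \<le> \<bar>\<rho>\<bar> * (2 powr \<beta> + 1) / \<beta>" "0 \<le> \<bar>\<rho>\<bar> * 2 powr \<bar>\<rho> - 1\<bar>"
      "0 \<le> \<bar>\<rho>\<bar> * \<bar>\<rho> - 1\<bar> * 2 powr \<bar>\<rho> - 2\<bar>" "0 \<le> 2 powr \<rho>"
      using \<beta> by auto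
    then have "2 powr \<rho> + \<bar>\<rho>\<bar> * (2 powr \<beta> + 1) / \<beta> \<le> C" "\<bar>\<rho>\<bar> * 2 powr \<bar>\<rho> - 1\<bar> \<le> C"
      "\<bar>\<rho>\<bar> * \<bar>\<rho> - 1\<bar> * 2 powr \<bar>\<rho> - 2\<bar> \<le> C"
      unfolding C_def \<beta>_def[symmetric] by linarith+
    then show ?thesis
      using assms(1) K_nonneg D by (intro add_mono mult_right_mono) auto
  qed
  finally show ?thesis
    unfolding D_def \<beta>_def by (simp only: distrib_left)
qed

text \<open>Both endpoints are at most \<open>2 * h\<close>, so the growth bound at each of them is
  already of the right order.\<close>

lemma regularized_increment_far:
  assumes "0 \<le> v" "v < h" "v + h \<le> T"
  shows "\<bar>regularized (v + h) - regularized v\<bar>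
    \<le> (1 + \<bar>\<rho>\<bar> / (\<alpha> + \<rho>)) * 2 * 2 powr (\<alpha> + \<rho>) * K * h powr (\<alpha> + \<rho>)"
proof -
  let ?C = "(1 + \<bar>\<rho>\<bar> / (\<alpha> + \<rho>)) * K"
  have C: "0 \<le> ?C" using sum_pos K_nonneg by simp
  have *: "\<bar>regularized x\<bar> \<le> ?C * (2 powr (\<alpha> + \<rho>) * h powr (\<alpha> + \<rho>))"
    if "0 \<le> x" "x \<le> 2 * h" "x \<le> T" for x
  proof -
    have "\<bar>regularized x\<bar> \<le> ?C * x powr (\<alpha> + \<rho>)"
      using regularized_growth[of x] that by simp
    also have "\<dots> \<le> ?C * (2 * h) powr (\<alpha> + \<rho>)"
      using that C sum_pos by (intro mult_left_mono powr_mono2) auto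
    finally show ?thesis using assms by (simp add: powr_mult)
  qed
  have "\<bar>regularized (v + h) - regularized v\<bar> \<le> \<bar>regularized (v + h)\<bar> + \<bar>regularized v\<bar>"
    by (rule abs_triangle_ineq4)
  also have "\<dots> \<le> 2 * (?C * (2 powr (\<alpha> + \<rho>) * h powr (\<alpha> + \<rho>)))"
    using *[of v] *[of "v + h"] assms by linarith
  finally show ?thesis by (simp only: mult_ac)
qed

end

section \<open>The common modulus of continuity and its three regimes\<close>

text \<open>For \<open>\<beta> = 1\<close> the added 1 keeps the modulus of order \<open>h\<close>
  up to \<open>h = T\<close>, where the logarithm vanishes.\<close>

definition Holder_modulus :: "real \<Rightarrow> real \<Rightarrow> real \<Rightarrow> real" where
  "Holder_modulus \<beta> T h = (if \<beta> = 1 then h * (1 + ln (T / h)) else h powr min 1 \<beta>)"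

lemma Holder_modulus_nonneg: "0 < h \<Longrightarrow> h \<le> T \<Longrightarrow> 0 \<le> Holder_modulus \<beta> T h"
  by (simp add: Holder_modulus_def)

text \<open>The remaining integral is elementary: \<open>ln v - ln h\<close> if
  \<open>\<beta> = 1\<close>, otherwise a difference of powers with exponent
  \<open>\<beta> - 1\<close>. The dominant power is that of \<open>h\<close> if
  \<open>\<beta> < 1\<close>, giving \<open>h powr \<beta>\<close>, and is at most that of
  \<open>T\<close> if \<open>\<beta> > 1\<close>, giving order \<open>h\<close>.\<close>

lemma near_terms_le_Holder_modulus:
  assumes "0 < \<beta>" "0 < T"
  shows "\<exists>c\<ge>0. \<forall>h v. 0 < h \<longrightarrow> h \<le> v \<longrightarrow> v \<le> T \<longrightarrow>
    h powr \<beta> + h * v powr (\<beta> - 1) + h * integral {0..v - h} (\<lambda>y. (v - y) powr (\<beta> - 2))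
    \<le> c * Holder_modulus \<beta> T h"
proof (cases "\<beta> = 1")
  case True
  have "h powr \<beta> + h * v powr (\<beta> - 1) + h * integral {0..v - h} (\<lambda>y. (v - y) powr (\<beta> - 2))
      \<le> 2 * Holder_modulus \<beta> T h" if h: "0 < h" "h \<le> v" "v \<le> T" for h v
  proof -
    have "((\<lambda>y. 1 / (v - y)) has_integral - ln (v - (v - h)) - - ln (v - 0)) {0..v - h}"
    proof (rule fundamental_theorem_of_calculus)
      fix x assume x: "x \<in> {0..v - h}"
      have "((\<lambda>y. - ln (v - y)) has_real_derivative 1 / (v - x)) (at x within {0..v - h})"
        using x h by (auto intro!: derivative_eq_intros simp: field_simps)
      then show "((\<lambda>y. - ln (v - y)) has_vector_derivative 1 / (v - x)) (at x within {0..v - h})"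
        by (simp add: has_real_derivative_iff_has_vector_derivative)
    qed (use h in auto)
    moreover have "integral {0..v - h} (\<lambda>y. (v - y) powr (\<beta> - 2)) = integral {0..v - h} (\<lambda>y. 1 / (v - y))"
      using h True by (intro Henstock_Kurzweil_Integration.integral_cong)
        (auto simp: powr_minus_divide)
    ultimately have I: "integral {0..v - h} (\<lambda>y. (v - y) powr (\<beta> - 2)) = ln v - ln h"
      by (simp add: integral_unique)
    \<comment> \<open>To be used with the logarithms of \<open>v\<close>, \<open>h\<close> and
      \<open>T\<close>: \<open>v \<le> T\<close> enlarges the difference, and
      \<open>h \<le> T\<close> makes it nonnegative, so doubling it is harmless.\<close>
    have "2 + (x - y) \<le> 2 * (1 + (t - y))" if "x \<le> t" "y \<le> t" for x y t :: real
      using that by simp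
    moreover have "ln v \<le> ln T" "ln h \<le> ln T" using h by auto
    ultimately have key: "2 + (ln v - ln h) \<le> 2 * (1 + (ln T - ln h))" by blast
    have "h powr \<beta> + h * v powr (\<beta> - 1) + h * (ln v - ln h) = h * (2 + (ln v - ln h))"
      using h True by (simp add: distrib_left)
    also have "\<dots> \<le> h * (2 * (1 + (ln T - ln h)))"
      using h by (intro mult_left_mono[OF key]) simp
    also have "\<dots> = 2 * Holder_modulus \<beta> T h"
      using h assms True by (simp add: Holder_modulus_def ln_div)
    finally show ?thesis unfolding I .
  qed
  then show ?thesis by (intro exI[of _ 2]) auto
next
  case False
  define c where "c = (2 + 1 / \<bar>\<beta> - 1\<bar>) * (1 + T powr (\<beta> - 1))"
  have "h powr \<beta> + h * v powr (\<beta> - 1) + h * integral {0..v - h} (\<lambda>y. (v - y) powr (\<beta> - 2))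
      \<le> c * Holder_modulus \<beta> T h" if h: "0 < h" "h \<le> v" "v \<le> T" for h v
  proof -
    \<comment> \<open>The difference of two nonnegative numbers is at most their maximum in absolute
      value, so \<open>m\<close> serves for both signs of \<open>\<beta> - 1\<close>.\<close>
    define m where "m = max (h powr (\<beta> - 1)) (v powr (\<beta> - 1))"
    have "((\<lambda>y. (\<beta> - 1) * (v - y) powr (\<beta> - 1 - 1)) has_integral
        v powr (\<beta> - 1) - (v - (v - h)) powr (\<beta> - 1)) {0..v - h}"
      using h by (intro has_integral_powr_away) auto
    from has_integral_mult_right[OF this, of "1 / (\<beta> - 1)"]
    have "((\<lambda>y. (v - y) powr (\<beta> - 2)) has_integral
        (v powr (\<beta> - 1) - h powr (\<beta> - 1)) / (\<beta> - 1)) {0..v - h}"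
      using False by simp
    then have I: "integral {0..v - h} (\<lambda>y. (v - y) powr (\<beta> - 2))
        = (v powr (\<beta> - 1) - h powr (\<beta> - 1)) / (\<beta> - 1)"
      by (rule integral_unique)
    have "\<bar>v powr (\<beta> - 1) - h powr (\<beta> - 1)\<bar> \<le> m"
      unfolding m_def using powr_ge_zero[of h "\<beta> - 1"] powr_ge_zero[of v "\<beta> - 1"] by linarith
    then have "\<bar>(v powr (\<beta> - 1) - h powr (\<beta> - 1)) / (\<beta> - 1)\<bar> \<le> m / \<bar>\<beta> - 1\<bar>"
      unfolding abs_divide by (rule divide_right_mono) simp
    then have "(v powr (\<beta> - 1) - h powr (\<beta> - 1)) / (\<beta> - 1) \<le> m / \<bar>\<beta> - 1\<bar>"
      by linarith
    moreover have "h powr (\<beta> - 1) \<le> m" "v powr (\<beta> - 1) \<le> m"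
      by (auto simp: m_def)
    ultimately have "h powr (\<beta> - 1) + v powr (\<beta> - 1)
        + integral {0..v - h} (\<lambda>y. (v - y) powr (\<beta> - 2)) \<le> (2 + 1 / \<bar>\<beta> - 1\<bar>) * m"
      unfolding I by (simp add: distrib_right)
    then have "h * (h powr (\<beta> - 1) + v powr (\<beta> - 1)
        + integral {0..v - h} (\<lambda>y. (v - y) powr (\<beta> - 2))) \<le> h * ((2 + 1 / \<bar>\<beta> - 1\<bar>) * m)"
      using h by (intro mult_left_mono) auto
    also have "\<dots> = (2 + 1 / \<bar>\<beta> - 1\<bar>) * (h * m)"
      by simp
    also have "\<dots> \<le> (2 + 1 / \<bar>\<beta> - 1\<bar>) * ((1 + T powr (\<beta> - 1)) * Holder_modulus \<beta> T h)"
    proof (rule mult_left_mono)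
      show "h * m \<le> (1 + T powr (\<beta> - 1)) * Holder_modulus \<beta> T h"
      proof (cases "\<beta> < 1")
        case True
        then have "v powr (\<beta> - 1) \<le> h powr (\<beta> - 1)"
          using h by (intro powr_mono2') auto
        then have "h * m = Holder_modulus \<beta> T h"
          using True h by (simp add: m_def Holder_modulus_def powr_diff)
        then show ?thesis
          using Holder_modulus_nonneg[of h T \<beta>] h by (simp add: distrib_right)
      next
        case False
        then have "h powr (\<beta> - 1) \<le> T powr (\<beta> - 1)" "v powr (\<beta> - 1) \<le> T powr (\<beta> - 1)"
          using h by (auto intro!: powr_mono2)
        then have "m \<le> 1 + T powr (\<beta> - 1)" by (simp add: m_def)
        then have "h * m \<le> h * (1 + T powr (\<beta> - 1))"
          using h by (intro mult_left_mono) auto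
        then show ?thesis
          using False \<open>\<beta> \<noteq> 1\<close> h by (simp add: Holder_modulus_def mult.commute)
      qed
    qed simp
    finally have "h * h powr (\<beta> - 1) + h * v powr (\<beta> - 1)
        + h * integral {0..v - h} (\<lambda>y. (v - y) powr (\<beta> - 2)) \<le> c * Holder_modulus \<beta> T h"
      by (simp only: c_def distrib_left[of h] mult.assoc)
    moreover have "h * h powr (\<beta> - 1) = h powr \<beta>"
      using h by (simp add: powr_diff)
    ultimately show ?thesis by simp
  qed
  then show ?thesis by (intro exI[of _ c]) (auto simp: c_def)
qed

text \<open>\<open>C\<close> is chosen before \<open>K\<close> and \<open>w\<close>. This uniformity
  over paths is what later keeps the random constant measurable.\<close>

lemma regularized_modulus:
  assumes "0 < \<alpha> + \<rho>" "0 < T"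
  shows "\<exists>C\<ge>0. \<forall>K w u v. Holder_path \<alpha> \<rho> T K w \<longrightarrow> u \<in> {0..T} \<longrightarrow> v \<in> {0..T} \<longrightarrow> u \<noteq> v \<longrightarrow>
    \<bar>Holder_path.regularized \<rho> w u - Holder_path.regularized \<rho> w v\<bar>
    \<le> C * K * Holder_modulus (\<alpha> + \<rho>) T \<bar>u - v\<bar>"
proof -
  obtain c where c: "0 \<le> c" and near: "\<And>h v. 0 < h \<Longrightarrow> h \<le> v \<Longrightarrow> v \<le> T \<Longrightarrow>
      h powr (\<alpha> + \<rho>) + h * v powr (\<alpha> + \<rho> - 1)
      + h * integral {0..v - h} (\<lambda>y. (v - y) powr (\<alpha> + \<rho> - 2)) \<le> c * Holder_modulus (\<alpha> + \<rho>) T h"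
    using near_terms_le_Holder_modulus[OF assms] by blast
  \<comment> \<open>The case \<open>v = h\<close> of \<open>near\<close>, where the integral is over
    a single point and the middle term is nonnegative.\<close>
  have far: "h powr (\<alpha> + \<rho>) \<le> c * Holder_modulus (\<alpha> + \<rho>) T h" if "0 < h" "h \<le> T" for h
  proof -
    have "integral {0..h - h} (\<lambda>y. (h - y) powr (\<alpha> + \<rho> - 2)) = 0" by simp
    from near[OF that(1) order_refl that(2), unfolded this]
    show ?thesis using that by (smt (verit) mult_nonneg_nonneg mult_zero_right powr_ge_zero)
  qed
  define C1 where "C1 = 2 powr \<rho> + \<bar>\<rho>\<bar> * 2 powr \<bar>\<rho> - 1\<bar>
    + \<bar>\<rho>\<bar> * (2 powr (\<alpha> + \<rho>) + 1) / (\<alpha> + \<rho>) + \<bar>\<rho>\<bar> * \<bar>\<rho> - 1\<bar> * 2 powr \<bar>\<rho> - 2\<bar>"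
  define C2 where "C2 = (1 + \<bar>\<rho>\<bar> / (\<alpha> + \<rho>)) * 2 * 2 powr (\<alpha> + \<rho>)"
  have C12: "0 \<le> C1" "0 \<le> C2" using assms by (auto simp: C1_def C2_def)
  have increment: "\<bar>Holder_path.regularized \<rho> w (v + h) - Holder_path.regularized \<rho> w v\<bar>
      \<le> (C1 + C2) * c * K * Holder_modulus (\<alpha> + \<rho>) T h"
    if w: "Holder_path \<alpha> \<rho> T K w" and h: "0 \<le> v" "0 < h" "v + h \<le> T" for K w v h
  proof -
    interpret Holder_path \<alpha> \<rho> T K w by fact
    let ?m = "c * Holder_modulus (\<alpha> + \<rho>) T h"
    have m: "0 \<le> ?m" using c Holder_modulus_nonneg h by simp
    have "\<bar>regularized (v + h) - regularized v\<bar> \<le> (C1 + C2) * K * ?m"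
    proof (cases "h \<le> v")
      case True
      then have "\<bar>regularized (v + h) - regularized v\<bar> \<le> C1 * K * (h powr (\<alpha> + \<rho>)
          + h * v powr (\<alpha> + \<rho> - 1) + h * integral {0..v - h} (\<lambda>y. (v - y) powr (\<alpha> + \<rho> - 2)))"
        using regularized_increment_near[of h v] h unfolding C1_def by blast
      also have "\<dots> \<le> C1 * K * ?m"
        using near[of h v] True h C12 K_nonneg by (intro mult_left_mono) auto
      also have "\<dots> \<le> (C1 + C2) * K * ?m"
        using C12 K_nonneg m by (intro mult_right_mono) auto
      finally show ?thesis .
    next
      case False
      then have "\<bar>regularized (v + h) - regularized v\<bar> \<le> C2 * K * h powr (\<alpha> + \<rho>)"
        using regularized_increment_far[of v h] h unfolding C2_def by simp
      also have "\<dots> \<le> C2 * K * ?m"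
        using far[of h] h C12 K_nonneg by (intro mult_left_mono) auto
      also have "\<dots> \<le> (C1 + C2) * K * ?m"
        using C12 K_nonneg m by (intro mult_right_mono) auto
      finally show ?thesis .
    qed
    then show ?thesis by (simp add: mult_ac)
  qed
  show ?thesis
  proof (intro exI[of _ "(C1 + C2) * c"] conjI allI impI)
    fix K w u v assume w: "Holder_path \<alpha> \<rho> T K w" and uv: "u \<in> {0..T}" "v \<in> {0..T}" "u \<noteq> v"
    show "\<bar>Holder_path.regularized \<rho> w u - Holder_path.regularized \<rho> w v\<bar>
      \<le> (C1 + C2) * c * K * Holder_modulus (\<alpha> + \<rho>) T \<bar>u - v\<bar>"
    proof (cases "v < u")
      case True
      then show ?thesis using increment[OF w, of v "u - v"] uv by simp
    next
      case False
      then show ?thesis using increment[OF w, of u "v - u"] uv by (simp add: abs_minus_commute)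
    qed
  qed (use C12 c in auto)
qed

section \<open>The value at the origin and the identification with the process\<close>

lemma (in Holder_path) frac_path_pos_tendsto_0: "(frac_path_pos \<rho> w \<longlongrightarrow> 0) (at_right 0)"
proof (rule Lim_null_comparison)
  have "eventually (\<lambda>u. u \<in> {0<..<T}) (at_right 0)"
    using T_pos by (intro eventually_at_right_real)
  then show "\<forall>\<^sub>F u in at_right 0. norm (frac_path_pos \<rho> w u)
      \<le> (1 + \<bar>\<rho>\<bar> / (\<alpha> + \<rho>)) * K * u powr (\<alpha> + \<rho>)"
    by eventually_elim (use regularized_growth in \<open>auto simp: frac_path_pos_eq_regularized\<close>)
  have "((\<lambda>u. (1 + \<bar>\<rho>\<bar> / (\<alpha> + \<rho>)) * K * u powr (\<alpha> + \<rho>)) \<longlongrightarrow>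
      (1 + \<bar>\<rho>\<bar> / (\<alpha> + \<rho>)) * K * 0 powr (\<alpha> + \<rho>)) (at_right 0)"
    using sum_pos
    by (intro tendsto_intros tendsto_powr') (auto simp: eventually_at_right_less eventually_at_filter)
  then show "((\<lambda>u. (1 + \<bar>\<rho>\<bar> / (\<alpha> + \<rho>)) * K * u powr (\<alpha> + \<rho>)) \<longlongrightarrow> 0) (at_right 0)"
    by simp
qed

text \<open>At the origin, \<open>Lim\<close> evaluates to 0 if \<open>\<rho> \<noteq> 0\<close>,
  and the value is \<open>w 0 = 0\<close> if \<open>\<rho> = 0\<close>; both agree with
  \<open>regularized 0\<close>.\<close>

lemma frac_process_eq_regularized:
  assumes "Holder_path \<alpha> \<rho> T K (\<lambda>t. W t \<omega>)" "u \<in> {0..T}"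
  shows "frac_process \<rho> W u \<omega> = Holder_path.regularized \<rho> (\<lambda>t. W t \<omega>) u"
proof -
  interpret Holder_path \<alpha> \<rho> T K "\<lambda>t. W t \<omega>" by fact
  show ?thesis
  proof (cases "u = 0")
    case True
    have "Lim (at_right 0) (frac_path_pos \<rho> (\<lambda>t. W t \<omega>)) = 0"
      by (rule tendsto_Lim[OF _ frac_path_pos_tendsto_0]) simp
    then show ?thesis
      using True w_0 by (simp add: frac_process_def regularized_0 frac_path_pos_def)
  next
    case False
    then show ?thesis
      using assms by (simp add: frac_process_def frac_path_pos_eq_regularized)
  qed
qed

section \<open>Comparison of the logarithmic modulus with the two stated forms\<close>

text \<open>With \<open>x = T / h \<ge> 1\<close> and \<open>a = 1 - \<gamma>\<close>, both
  \<open>1 \<le> x powr a\<close> and \<open>ln x \<le> x powr a / a\<close> hold, and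
  \<open>h * x powr a = T powr a * h powr \<gamma>\<close>.\<close>

lemma linear_log_le_powr:
  fixes h T \<gamma> :: real
  assumes "0 < h" "h \<le> T" "\<gamma> < 1"
  shows "h * (1 + ln (T / h)) \<le> (1 + 1 / (1 - \<gamma>)) * T powr (1 - \<gamma>) * h powr \<gamma>"
proof -
  have x: "1 \<le> (T / h) powr (1 - \<gamma>)"
    using assms by (intro ge_one_powr_ge_zero) auto
  moreover have "ln (T / h) \<le> (T / h) powr (1 - \<gamma>) / (1 - \<gamma>)"
    using assms by (intro ln_powr_bound) auto
  ultimately have "h * (1 + ln (T / h)) \<le> h * ((T / h) powr (1 - \<gamma>) * (1 + 1 / (1 - \<gamma>)))"
    using assms by (intro mult_left_mono) (auto simp: distrib_left)
  also have "\<dots> = (1 + 1 / (1 - \<gamma>)) * T powr (1 - \<gamma>) * (h / h powr (1 - \<gamma>))"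
    using assms by (simp add: powr_divide)
  also have "h / h powr (1 - \<gamma>) = h powr \<gamma>"
    using assms by (simp add: powr_diff)
  finally show ?thesis .
qed

text \<open>The strict inequality \<open>T < Tstar\<close> bounds \<open>ln (Tstar / h)\<close>
  below by \<open>ln (Tstar / T) > 0\<close>, so a multiple of it absorbs the summand 1.\<close>

lemma linear_log_le_log:
  fixes h T Tstar :: real
  assumes "0 < h" "h \<le> T" "T < Tstar"
  shows "h * (1 + ln (T / h)) \<le> (1 + 1 / ln (Tstar / T)) * (h * ln (Tstar / h))"
proof -
  have "0 < ln (Tstar / T)" "ln (Tstar / T) \<le> ln (Tstar / h)" "ln (T / h) \<le> ln (Tstar / h)"
    using assms by (auto simp: divide_simps)
  moreover have "1 + x \<le> (1 + 1 / b) * y" if "0 < b" "b \<le> y" "x \<le> y" for b x y :: real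
  proof -
    have "1 \<le> y / b" using that by simp
    moreover have "(1 + 1 / b) * y = y + y / b" by (simp add: distrib_right)
    ultimately show ?thesis using that by linarith
  qed
  ultimately have "1 + ln (T / h) \<le> (1 + 1 / ln (Tstar / T)) * ln (Tstar / h)"
    by blast
  then have "h * (1 + ln (T / h)) \<le> h * ((1 + 1 / ln (Tstar / T)) * ln (Tstar / h))"
    using assms by (intro mult_left_mono) auto
  then show ?thesis by (simp add: mult_ac)
qed

section \<open>Almost sure statements for the process\<close>

theorem lemma2p1:
  fixes M :: "'a measure" and W :: "real \<Rightarrow> 'a \<Rightarrow> real" and \<alpha> \<rho> :: real
  assumes "prob_space M"
    and "\<alpha> > 0"
    and "gaussian_process M W"
    and "centered_process M W"
    and "as_locally_Holder M \<alpha> W"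
    and "AE \<omega> in M. W 0 \<omega> = 0"
    and "\<rho> > - \<alpha>"
  shows
    "\<comment> \<open>the limit defining the value at 0 exists and is 0\<close>
     (\<rho> \<noteq> 0 \<longrightarrow> (AE \<omega> in M. ((\<lambda>u. frac_process \<rho> W u \<omega>) \<longlongrightarrow> 0) (at_right 0)
                         \<and> frac_process \<rho> W 0 \<omega> = 0)) \<and>
     \<comment> \<open>1)\<close>
     (\<rho> \<noteq> 0 \<longrightarrow> (\<forall>u>0. AE \<omega> in M.
        set_integrable lborel {0..u} (frac_integrand \<rho> (\<lambda>t. W t \<omega>) u))) \<and>
     \<comment> \<open>2)\<close>
     (\<alpha> + \<rho> \<noteq> 1 \<longrightarrow> as_locally_Holder M (min 1 (\<alpha> + \<rho>)) (frac_process \<rho> W)) \<and>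
     (\<alpha> + \<rho> = 1 \<longrightarrow>
        (\<forall>\<gamma>. 0 < \<gamma> \<and> \<gamma> < 1 \<longrightarrow> as_locally_Holder M \<gamma> (frac_process \<rho> W)) \<and>
        (\<forall>T>0. \<forall>Tstar>T. AE \<omega> in M.
           (SUP (u, v) \<in> {(u, v). u \<in> {0..T} \<and> v \<in> {0..T} \<and> u \<noteq> v}.
              ereal (\<bar>frac_process \<rho> W u \<omega> - frac_process \<rho> W v \<omega>\<bar>
                     / (\<bar>u - v\<bar> * ln (Tstar / \<bar>u - v\<bar>)))) < \<infinity>))"
proof -
  have pos: "0 < \<alpha> + \<rho>" using assms(7) by simp
  have paths: "\<exists>K\<in>borel_measurable M. AE \<omega> in M. Holder_path \<alpha> \<rho> T (K \<omega>) (\<lambda>t. W t \<omega>)"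
    if T: "0 < T" for T
  proof -
    obtain K where K: "K \<in> borel_measurable M" and AE: "AE \<omega> in M.
        \<forall>x\<in>{0..T}. \<forall>y\<in>{0..T}. \<bar>W x \<omega> - W y \<omega>\<bar> \<le> K \<omega> * \<bar>x - y\<bar> powr \<alpha>"
      using assms(5) T unfolding as_locally_Holder_def by blast
    from AE assms(6) have "AE \<omega> in M. Holder_path \<alpha> \<rho> T (K \<omega>) (\<lambda>t. W t \<omega>)"
      by eventually_elim (use assms(2) pos T in \<open>unfold_locales, auto\<close>)
    with K show ?thesis by blast
  qed
  \<comment> \<open>Nonnegativity of the random constant is carried along because comparisons of
    moduli are later multiplied by it.\<close>
  have modulus: "\<exists>K\<in>borel_measurable M. AE \<omega> in M. 0 \<le> K \<omega> \<and>
      (\<forall>u\<in>{0..T}. \<forall>v\<in>{0..T}. u \<noteq> v \<longrightarrow> \<bar>frac_process \<rho> W u \<omega> - frac_process \<rho> W v \<omega>\<bar>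
        \<le> K \<omega> * Holder_modulus (\<alpha> + \<rho>) T \<bar>u - v\<bar>)" if T: "0 < T" for T
  proof -
    obtain K where K: "K \<in> borel_measurable M"
      and AE: "AE \<omega> in M. Holder_path \<alpha> \<rho> T (K \<omega>) (\<lambda>t. W t \<omega>)"
      using paths[OF T] by blast
    obtain C where C: "0 \<le> C" and inc: "\<And>K w u v. Holder_path \<alpha> \<rho> T K w \<Longrightarrow> u \<in> {0..T} \<Longrightarrow>
        v \<in> {0..T} \<Longrightarrow> u \<noteq> v \<Longrightarrow>
        \<bar>Holder_path.regularized \<rho> w u - Holder_path.regularized \<rho> w v\<bar>
          \<le> C * K * Holder_modulus (\<alpha> + \<rho>) T \<bar>u - v\<bar>"
      using regularized_modulus[OF pos T] by blast
    from AE have "AE \<omega> in M. 0 \<le> C * K \<omega> \<and>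
      (\<forall>u\<in>{0..T}. \<forall>v\<in>{0..T}. u \<noteq> v \<longrightarrow> \<bar>frac_process \<rho> W u \<omega> - frac_process \<rho> W v \<omega>\<bar>
        \<le> C * K \<omega> * Holder_modulus (\<alpha> + \<rho>) T \<bar>u - v\<bar>)"
    proof eventually_elim
      fix \<omega> assume path: "Holder_path \<alpha> \<rho> T (K \<omega>) (\<lambda>t. W t \<omega>)"
      show "0 \<le> C * K \<omega> \<and>
      (\<forall>u\<in>{0..T}. \<forall>v\<in>{0..T}. u \<noteq> v \<longrightarrow> \<bar>frac_process \<rho> W u \<omega> - frac_process \<rho> W v \<omega>\<bar>
        \<le> C * K \<omega> * Holder_modulus (\<alpha> + \<rho>) T \<bar>u - v\<bar>)"
        using C Holder_path.K_nonneg[OF path] inc[OF path]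
          frac_process_eq_regularized[where W = W and \<omega> = \<omega>, OF path]
        by simp
    qed
    with K show ?thesis by (intro bexI[of _ "\<lambda>\<omega>. C * K \<omega>"]) auto
  qed
  \<comment> \<open>The comparison constant may depend on \<open>T\<close> but not on the sample
    point, so \<open>K \<omega> * c\<close> is again measurable.\<close>
  have Holder_of_modulus: "as_locally_Holder M \<gamma> (frac_process \<rho> W)"
    if \<gamma>: "0 < \<gamma>" and le: "\<And>T. 0 < T \<Longrightarrow> \<exists>c\<ge>0. \<forall>h. 0 < h \<longrightarrow> h \<le> T \<longrightarrow>
      Holder_modulus (\<alpha> + \<rho>) T h \<le> c * h powr \<gamma>" for \<gamma>
    unfolding as_locally_Holder_def
  proof (intro conjI allI impI \<gamma>)
    fix T :: real assume T: "0 < T"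
    obtain K where K: "K \<in> borel_measurable M" and AE: "AE \<omega> in M. 0 \<le> K \<omega> \<and>
      (\<forall>u\<in>{0..T}. \<forall>v\<in>{0..T}. u \<noteq> v \<longrightarrow> \<bar>frac_process \<rho> W u \<omega> - frac_process \<rho> W v \<omega>\<bar>
        \<le> K \<omega> * Holder_modulus (\<alpha> + \<rho>) T \<bar>u - v\<bar>)"
      using modulus[OF T] by blast
    obtain c where c: "\<And>h. 0 < h \<Longrightarrow> h \<le> T \<Longrightarrow> Holder_modulus (\<alpha> + \<rho>) T h \<le> c * h powr \<gamma>"
      using le[OF T] by blast
    from AE have "AE \<omega> in M. \<forall>x\<in>{0..T}. \<forall>y\<in>{0..T}.
        \<bar>frac_process \<rho> W x \<omega> - frac_process \<rho> W y \<omega>\<bar> \<le> K \<omega> * c * \<bar>x - y\<bar> powr \<gamma>"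
    proof eventually_elim
      case (elim \<omega>)
      show ?case
      proof (intro ballI)
        fix x y assume xy: "x \<in> {0..T}" "y \<in> {0..T}"
        show "\<bar>frac_process \<rho> W x \<omega> - frac_process \<rho> W y \<omega>\<bar> \<le> K \<omega> * c * \<bar>x - y\<bar> powr \<gamma>"
        proof (cases "x = y")
          case False
          have "K \<omega> * Holder_modulus (\<alpha> + \<rho>) T \<bar>x - y\<bar> \<le> K \<omega> * (c * \<bar>x - y\<bar> powr \<gamma>)"
            using elim False xy by (intro mult_left_mono c) auto
          with elim False xy show ?thesis by (fastforce simp: mult.assoc)
        qed simp
      qed
    qed
    with K show "\<exists>K\<in>borel_measurable M. AE \<omega> in M. \<forall>x\<in>{0..T}. \<forall>y\<in>{0..T}.
        \<bar>frac_process \<rho> W x \<omega> - frac_process \<rho> W y \<omega>\<bar> \<le> K \<omega> * \<bar>x - y\<bar> powr \<gamma>"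
      by (intro bexI[of _ "\<lambda>\<omega>. K \<omega> * c"]) auto
  qed
  show ?thesis
  proof (intro conjI impI allI)
    assume "\<rho> \<noteq> 0"
    \<comment> \<open>Only times near 0 matter here, so the horizon 1 is an arbitrary
      choice.\<close>
    obtain K where "AE \<omega> in M. Holder_path \<alpha> \<rho> 1 (K \<omega>) (\<lambda>t. W t \<omega>)"
      using paths[of 1] by auto
    then show "AE \<omega> in M. ((\<lambda>u. frac_process \<rho> W u \<omega>) \<longlongrightarrow> 0) (at_right 0) \<and> frac_process \<rho> W 0 \<omega> = 0"
    proof eventually_elim
      case (elim \<omega>)
      then interpret Holder_path \<alpha> \<rho> 1 "K \<omega>" "\<lambda>t. W t \<omega>" .
      have "eventually (\<lambda>u. frac_path_pos \<rho> (\<lambda>t. W t \<omega>) u = frac_process \<rho> W u \<omega>) (at_right 0)"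
        by (auto simp: frac_process_def eventually_at_filter)
      with frac_path_pos_tendsto_0 show ?case
        using frac_process_eq_regularized[where W = W and \<omega> = \<omega> and u = 0, OF elim] regularized_0
        by (auto intro: Lim_transform_eventually)
    qed
  next
    fix u :: real assume "\<rho> \<noteq> 0" "0 < u"
    obtain K where "AE \<omega> in M. Holder_path \<alpha> \<rho> u (K \<omega>) (\<lambda>t. W t \<omega>)"
      using paths[OF \<open>0 < u\<close>] by auto
    then show "AE \<omega> in M. set_integrable lborel {0..u} (frac_integrand \<rho> (\<lambda>t. W t \<omega>) u)"
      by eventually_elim
        (use \<open>\<rho> \<noteq> 0\<close> \<open>0 < u\<close> in \<open>auto intro!: Holder_path.set_integrable_frac_integrand\<close>)
  next
    assume "\<alpha> + \<rho> \<noteq> 1"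
    then show "as_locally_Holder M (min 1 (\<alpha> + \<rho>)) (frac_process \<rho> W)"
      using pos by (intro Holder_of_modulus exI[of _ 1]) (auto simp: Holder_modulus_def)
  next
    fix \<gamma> :: real assume "\<alpha> + \<rho> = 1" and \<gamma>: "0 < \<gamma> \<and> \<gamma> < 1"
    show "as_locally_Holder M \<gamma> (frac_process \<rho> W)"
    proof (rule Holder_of_modulus)
      fix T :: real assume "0 < T"
      show "\<exists>c\<ge>0. \<forall>h. 0 < h \<longrightarrow> h \<le> T \<longrightarrow> Holder_modulus (\<alpha> + \<rho>) T h \<le> c * h powr \<gamma>"
        using \<gamma> \<open>\<alpha> + \<rho> = 1\<close> linear_log_le_powr[of _ T \<gamma>]
        by (intro exI[of _ "(1 + 1 / (1 - \<gamma>)) * T powr (1 - \<gamma>)"]) (auto simp: Holder_modulus_def)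
    qed (use \<gamma> in simp)
  next
    fix T Tstar :: real assume "\<alpha> + \<rho> = 1" and T: "0 < T" "T < Tstar"
    obtain K where AE: "AE \<omega> in M. 0 \<le> K \<omega> \<and>
      (\<forall>u\<in>{0..T}. \<forall>v\<in>{0..T}. u \<noteq> v \<longrightarrow> \<bar>frac_process \<rho> W u \<omega> - frac_process \<rho> W v \<omega>\<bar>
        \<le> K \<omega> * Holder_modulus (\<alpha> + \<rho>) T \<bar>u - v\<bar>)"
      using modulus[OF T(1)] by blast
    define c where "c = 1 + 1 / ln (Tstar / T)"
    from AE show "AE \<omega> in M. (SUP (u, v) \<in> {(u, v). u \<in> {0..T} \<and> v \<in> {0..T} \<and> u \<noteq> v}.
              ereal (\<bar>frac_process \<rho> W u \<omega> - frac_process \<rho> W v \<omega>\<bar>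
                     / (\<bar>u - v\<bar> * ln (Tstar / \<bar>u - v\<bar>)))) < \<infinity>"
    proof eventually_elim
      case (elim \<omega>)
      have "\<bar>frac_process \<rho> W u \<omega> - frac_process \<rho> W v \<omega>\<bar> / (\<bar>u - v\<bar> * ln (Tstar / \<bar>u - v\<bar>))
          \<le> K \<omega> * c" if uv: "u \<in> {0..T}" "v \<in> {0..T}" "u \<noteq> v" for u v
      proof -
        have h: "0 < \<bar>u - v\<bar>" "\<bar>u - v\<bar> \<le> T" using uv by auto
        \<comment> \<open>Positivity of the denominator turns the increment bound into a bound on
          the quotient, uniform in \<open>u\<close> and \<open>v\<close>.\<close>
        then have l: "0 < ln (Tstar / \<bar>u - v\<bar>)" using T by (simp add: divide_simps)
        have "\<bar>frac_process \<rho> W u \<omega> - frac_process \<rho> W v \<omega>\<bar>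
            \<le> K \<omega> * Holder_modulus (\<alpha> + \<rho>) T \<bar>u - v\<bar>"
          using elim uv by blast
        also have "\<dots> \<le> K \<omega> * (c * (\<bar>u - v\<bar> * ln (Tstar / \<bar>u - v\<bar>)))"
          using linear_log_le_log[OF h T(2)] elim \<open>\<alpha> + \<rho> = 1\<close>
          by (intro mult_left_mono) (auto simp: Holder_modulus_def c_def)
        finally show ?thesis
          using h(1) l by (simp add: pos_divide_le_eq mult.assoc)
      qed
      then have "(SUP (u, v) \<in> {(u, v). u \<in> {0..T} \<and> v \<in> {0..T} \<and> u \<noteq> v}.
              ereal (\<bar>frac_process \<rho> W u \<omega> - frac_process \<rho> W v \<omega>\<bar>
                     / (\<bar>u - v\<bar> * ln (Tstar / \<bar>u - v\<bar>)))) \<le> ereal (K \<omega> * c)"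
        by (intro SUP_least) auto
      also have "\<dots> < \<infinity>" by simp
      finally show ?case .
    qed
  qed
qed

end
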